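(* Let $n\ge 12$ be even. There is no feasible, single-break, ranking-fair schedule for $n$ teams whose D-sequence is a cyclic rotation, or the reversal of a cyclic rotation, of $(2,2,\dots,2,1)$ (i.e., the canonical pattern set does not allow a ranking-fair schedule).
   Context: Teams are $T=\{1,\dots,n\}$ ($n$ even), ranked by strength: team $i$ is stronger than team $j$ iff $i<j$. Rounds are $R=\{1,\dots,n-1\}$. A schedule assigns to each unordered pair of distinct teams a round in $R$ and designates which of the two plays at home (the other away). It is feasible if every team plays exactly one game in every round. The ranking HAP of team $i$ is the vector $(p_1,\dots,p_{n-1})$, $p_m\in\{H,A\}$ indicating whether team $i$ plays home or away against its $m$-th strongest opponent (opponents in increasing order of index). A schedule is ranking-fair if every team's ranking HAP alternates between $H$ and $A$. The HAP of a team is $(h_1,\dots,h_{n-1})$ with $h_r$ its venue in round $r$, read cyclically ($h_0:=h_{n-1}$); a team has a break in round $r$ if $h_{r-1}=h_r$. A schedule is single-break if every team has exactly one break. In a feasible single-break schedule the breaks occur in exactly $n/2$ distinct rounds $r_1<\dots<r_{n/2}$ (two teams having a break in each); the D-sequence is $(d_1,\dots,d_{n/2})$ with $d_i=r_{i+1}-r_i$ and $r_{n/2+1}:=r_1+n-1$. The canonical pattern set is the HAP set of a single-break schedule with D-sequence $(2,\dots,2,1)$ (up to cyclic rotation and reversal), e.g. breaks in rounds $1,2,4,6,\dots,n-2$. *)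

theory Defs
  imports Main
begin

definition teams :: "nat \<Rightarrow> nat set" where
  "teams n = {1..n}"

definition rounds :: "nat \<Rightarrow> nat set" where
  "rounds n = {1..n - 1}"

definition pairings :: "nat \<Rightarrow> nat set set" where
  "pairings n = {e. e \<subseteq> teams n \<and> card e = 2}"

datatype venue = H | A

(* A game is the unordered pair {i, j}; host S {i, j} is the team that plays at home in it. *)
record schedule =
  game_round :: "nat set \<Rightarrow> nat"
  host :: "nat set \<Rightarrow> nat"

definition is_schedule :: "nat \<Rightarrow> schedule \<Rightarrow> bool" where
  "is_schedule n S \<longleftrightarrow> (\<forall>e \<in> pairings n. game_round S e \<in> rounds n \<and> host S e \<in> e)"

definition feasible :: "nat \<Rightarrow> schedule \<Rightarrow> bool" where
  "feasible n S \<longleftrightarrow> (\<forall>i \<in> teams n. \<forall>r \<in> rounds n.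
     \<exists>!e. e \<in> pairings n \<and> i \<in> e \<and> game_round S e = r)"

definition venue_in :: "schedule \<Rightarrow> nat \<Rightarrow> nat set \<Rightarrow> venue" where
  "venue_in S i e = (if host S e = i then H else A)"

(* A smaller index means a stronger team, so the m-th strongest opponent is the m-th smallest
   index other than i; m counts from 1. *)
definition ranked_opponent :: "nat \<Rightarrow> nat \<Rightarrow> nat \<Rightarrow> nat" where
  "ranked_opponent n i m = sorted_list_of_set (teams n - {i}) ! (m - 1)"

definition ranking_hap :: "nat \<Rightarrow> schedule \<Rightarrow> nat \<Rightarrow> nat \<Rightarrow> venue" where
  "ranking_hap n S i m = venue_in S i {i, ranked_opponent n i m}"

definition ranking_fair :: "nat \<Rightarrow> schedule \<Rightarrow> bool" where
  "ranking_fair n S \<longleftrightarrow> (\<forall>i \<in> teams n. \<forall>m. 1 \<le> m \<and> m < n - 1 \<longrightarrow>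
     ranking_hap n S i m \<noteq> ranking_hap n S i (m + 1))"

(* Well defined for feasible schedules, i in teams n and r in rounds n. *)
definition game_of :: "nat \<Rightarrow> schedule \<Rightarrow> nat \<Rightarrow> nat \<Rightarrow> nat set" where
  "game_of n S i r = (THE e. e \<in> pairings n \<and> i \<in> e \<and> game_round S e = r)"

definition hap :: "nat \<Rightarrow> schedule \<Rightarrow> nat \<Rightarrow> nat \<Rightarrow> venue" where
  "hap n S i r = venue_in S i (game_of n S i r)"

(* HAPs are read cyclically: the round before round 1 is round n - 1. *)
definition prev_round :: "nat \<Rightarrow> nat \<Rightarrow> nat" where
  "prev_round n r = (if r = 1 then n - 1 else r - 1)"

definition breaks :: "nat \<Rightarrow> schedule \<Rightarrow> nat \<Rightarrow> nat set" where
  "breaks n S i = {r \<in> rounds n. hap n S i (prev_round n r) = hap n S i r}"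

definition single_break :: "nat \<Rightarrow> schedule \<Rightarrow> bool" where
  "single_break n S \<longleftrightarrow> (\<forall>i \<in> teams n. card (breaks n S i) = 1)"

definition break_rounds :: "nat \<Rightarrow> schedule \<Rightarrow> nat list" where
  "break_rounds n S = sorted_list_of_set (\<Union>i \<in> teams n. breaks n S i)"

(* Cyclic gaps between consecutive break rounds.  The subtraction never truncates: the rounds
   are increasing, and the successor of the last one is taken to be r_1 + n - 1. *)
definition d_sequence :: "nat \<Rightarrow> schedule \<Rightarrow> nat list" where
  "d_sequence n S = (let rs = break_rounds n S in
     map (\<lambda>k. (if k + 1 < length rs then rs ! (k + 1) else rs ! 0 + (n - 1)) - rs ! k)
       [0..<length rs])"

(* The sequence (2, ..., 2, 1) of length n / 2. *)
definition canonical_d_sequence :: "nat \<Rightarrow> nat list" where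
  "canonical_d_sequence n = replicate (n div 2 - 1) 2 @ [1]"

end

theory Submission
  imports Defs
begin

text \<open>
  Ranking-fairness fixes the venue of every game up to one global bit: for \<open>i < j\<close> the host of
  \<open>{i, j}\<close> depends only on the parity of \<open>i + j\<close>. Hence the \<open>n = 2 M\<close> teams split by parity into
  two sides of size \<open>M\<close>, one with \<open>M\<close> and the other with \<open>M - 1\<close> home games per team. Let \<open>z\<close> be
  the break round that is followed immediately by another one. Counting home games shows that in
  round \<open>z\<close> one whole side is at home, which forces \<open>p\<close> to play \<open>p\<close> across the sides. In each of
  the rounds \<open>z - 2\<close>, \<open>z - 1\<close>, \<open>z + 1\<close>, \<open>z + 2\<close> one side is at home except for one team on each
  side; there every cross game joins some \<open>p\<close> to a larger \<open>q\<close>, and since the differences \<open>q - p\<close>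
  telescope, about \<open>M - 3\<close> of them equal 1. Only \<open>2 (M - 1)\<close> such games exist, so
  \<open>4 (M - 3) \<le> 2 (M - 1)\<close>, that is \<open>M \<le> 5\<close>.
\<close>

section \<open>Coding of the teams by side and position\<close>

text \<open>
  A team is coded by its side and its position in \<open>{1..M}\<close>; see \<open>team\<close> below for the decoding.
  In this form the host of a game no longer depends on the global bit.
\<close>
type_synonym code = "bool \<times> nat"

definition codes :: "nat \<Rightarrow> code set" where
  "codes M = UNIV \<times> {1..M}"

text \<open>In the interleaved order \<open>(True, p)\<close> sits at 2p - 1 and
  \<open>(False, p)\<close> at 2p, so across sides one comparison is weak and the other strict.
  Across sides the earlier code hosts, within a side the later one.\<close>

definition beats :: "code \<Rightarrow> code \<Rightarrow> bool" where
  "beats v w \<longleftrightarrow>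
     (if fst v = fst w then snd w < snd v else if fst v then snd v \<le> snd w else snd v < snd w)"

lemma beats_asym: "v \<noteq> w \<Longrightarrow> beats w v \<longleftrightarrow> \<not> beats v w"
  by (cases v; cases w) (auto simp: beats_def)

section \<open>Position differences in the games of one round\<close>

text \<open>An injection of \<open>{1..M}\<close> into itself permutes it and preserves the sum of
  its elements, which leaves no room for a strict increase.\<close>

lemma inflating_injection_is_id:
  fixes f :: "nat \<Rightarrow> nat"
  assumes inj: "inj_on f {1..M}" and range: "\<And>p. p \<in> {1..M} \<Longrightarrow> p \<le> f p \<and> f p \<le> M"
    and p: "p \<in> {1..M}"
  shows "f p = p"
proof (rule ccontr)
  assume "f p \<noteq> p"
  with range p have "p < f p" by force
  moreover have "f ` {1..M} = {1..M}"
    proof (intro card_subset_eq)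
    show "f ` {1..M} \<subseteq> {1..M}" using range by fastforce
    show "card (f ` {1..M}) = card {1..M}" by (rule card_image[OF inj])
  qed simp
  then have "(\<Sum>p\<in>{1..M}. f p) = (\<Sum>p\<in>{1..M}. p)"
    using sum.reindex[OF inj, of id] by simp
  moreover have "(\<Sum>p\<in>{1..M}. p) < (\<Sum>p\<in>{1..M}. f p)"
    using range p \<open>p < f p\<close> by (intro sum_strict_mono_ex1) auto
  ultimately show False by simp
qed

text \<open>Each difference d = g q - q is at least 1, so 2 - d is 1 for d = 1 and at most 0
  otherwise; summing gives the bound. The left side may be negative, hence the integers.\<close>

lemma card_tight_ge:
  fixes g :: "nat \<Rightarrow> nat"
  assumes fin: "finite D" and less: "\<And>q. q \<in> D \<Longrightarrow> q < g q"
  shows "2 * int (card D) - (\<Sum>q\<in>D. int (g q) - int q) \<le> int (card {q \<in> D. g q = q + 1})"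
proof -
  have "(\<Sum>q\<in>D. 2 - (int (g q) - int q)) \<le> (\<Sum>q\<in>D. if g q = q + 1 then 1 else 0)"
    using less by (intro sum_mono) force
  also have "\<dots> = int (card {q \<in> D. g q = q + 1})"
    using fin by (simp add: sum.If_cases Int_def)
  finally show ?thesis by (simp add: sum_subtractf)
qed

text \<open>Two teams of side \<open>s\<close> can meet only if one of them is the away team
  \<open>b\<close>, so nearly the whole side plays across. The differences of these games telescope
  to a small sum, and \<open>card_tight_ge\<close> then makes many of them equal to 1.\<close>

lemma near_round:
  fixes opp :: "code \<Rightarrow> code" and home :: "code \<Rightarrow> bool"
  assumes opp_in: "\<And>v. v \<in> codes M \<Longrightarrow> opp v \<in> codes M"
    and opp_opp: "\<And>v. v \<in> codes M \<Longrightarrow> opp (opp v) = v"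
    and opp_home: "\<And>v. v \<in> codes M \<Longrightarrow> home (opp v) \<longleftrightarrow> \<not> home v"
    and home_s: "\<And>q. q \<in> {1..M} \<Longrightarrow> home (s, q) \<longleftrightarrow> q \<noteq> b"
    and home_t: "\<And>q. q \<in> {1..M} \<Longrightarrow> home (\<not> s, q) \<longleftrightarrow> q = a"
    and ab: "a \<in> {1..M}" "b \<in> {1..M}"
    and less: "\<And>p q. q \<in> {1..M} \<Longrightarrow> home (s, q) \<Longrightarrow> opp (s, q) = (\<not> s, p) \<Longrightarrow> q < p"
  shows "int M - 3 - (int b - int a) \<le> int (card {q \<in> {1..M}. opp (s, q) = (\<not> s, q + 1)})"
proof -
  define D where "D = {q \<in> {1..M} - {b}. fst (opp (s, q)) = (\<not> s)}"
  define g where "g q = snd (opp (s, q))" for q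
  have D: "opp (s, q) = (\<not> s, g q)" "g q \<in> {1..M} - {a}" "q \<in> {1..M}" if "q \<in> D" for q
  proof -
    show 1: "opp (s, q) = (\<not> s, g q)" and 2: "q \<in> {1..M}"
      using that by (auto simp: D_def g_def prod_eq_iff)
    have "(s, q) \<in> codes M" using 2 by (simp add: codes_def)
    from opp_in[OF this] opp_home[OF this] 1 2 show "g q \<in> {1..M} - {a}"
      using home_s home_t that by (auto simp: codes_def D_def)
  qed
  have inj: "inj_on g D"
  proof (rule inj_onI)
    fix x y assume xy: "x \<in> D" "y \<in> D" "g x = g y"
    then have "opp (s, x) = opp (s, y)" using D(1) by metis
    then have "opp (opp (s, x)) = opp (opp (s, y))" by simp
    then show "x = y" using opp_opp xy D(3) by (simp add: codes_def)
  qed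
  have fin: "finite D" by (simp add: D_def)
  have "2 * int (card D) - (\<Sum>q\<in>D. int (g q) - int q) \<le> int (card {q \<in> D. g q = q + 1})"
  proof (rule card_tight_ge[OF fin])
    fix q assume "q \<in> D"
    then have "q \<in> {1..M}" "home (s, q)" using home_s by (auto simp: D_def)
    then show "q < g q" using less D(1)[OF \<open>q \<in> D\<close>] by blast
  qed
  also have "\<dots> \<le> int (card {q \<in> {1..M}. opp (s, q) = (\<not> s, q + 1)})"
  proof -
    have "{q \<in> D. g q = q + 1} \<subseteq> {q \<in> {1..M}. opp (s, q) = (\<not> s, q + 1)}"
    proof
      fix q assume "q \<in> {q \<in> D. g q = q + 1}"
      then have q: "q \<in> D" and g: "g q = q + 1" by blast+
      show "q \<in> {q \<in> {1..M}. opp (s, q) = (\<not> s, q + 1)}"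
        using D(1)[OF q] D(3)[OF q] unfolding g by blast
    qed
    then show ?thesis by (simp add: card_mono)
  qed
  \<comment> \<open>The differences sum to image positions minus domain positions. Both sets are
    complements in \<open>{1..M}\<close> of at most two elements, so the full sums cancel.\<close>
  finally have main: "2 * int (card D) - ((\<Sum>p\<in>g ` D. int p) - (\<Sum>q\<in>D. int q)) \<le> \<dots>"
    by (simp add: sum_subtractf sum.reindex[OF inj])
  have sumS: "(\<Sum>p\<in>{1..M} - A. int p) = (\<Sum>p\<in>{1..M}. int p) - (\<Sum>p\<in>A. int p)"
    if "A \<subseteq> {1..M}" for A
    using that by (simp add: sum_diff)
  have va: "(\<not> s, a) \<in> codes M" and vb: "(s, b) \<in> codes M" using ab by (auto simp: codes_def)
  \<comment> \<open>Either \<open>a\<close> and \<open>b\<close> meet, and only they drop out of the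
    sums, or each plays inside its own side, \<open>a\<close> against \<open>t\<close> and
    \<open>b\<close> against \<open>f\<close>, and these opponents drop out too.\<close>
  show ?thesis
  proof (cases "fst (opp (\<not> s, a)) = s")
    case True
    then obtain q where q: "opp (\<not> s, a) = (s, q)" by (auto simp: prod_eq_iff)
    have qb: "q = b"
      using opp_in[OF va] opp_home[OF va] home_t home_s ab by (auto simp: q codes_def)
    have ob: "opp (s, b) = (\<not> s, a)" using opp_opp[OF va] q qb by simp
    have "D = {1..M} - {b}"
    proof -
      have False if x: "x \<in> {1..M}" "x \<noteq> b" "fst (opp (s, x)) = s" for x
      proof -
        obtain y where y: "opp (s, x) = (s, y)" using x(3) by (auto simp: prod_eq_iff)
        have vx: "(s, x) \<in> codes M" using that by (simp add: codes_def)
        have "y = b" using opp_in[OF vx] opp_home[OF vx] that home_s by (auto simp: y codes_def)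
        then show False using opp_opp[OF vx] y ob by simp
      qed
      then show ?thesis by (force simp: D_def)
    qed
    moreover have "g ` D = {1..M} - {a}"
    proof
      show "g ` D \<subseteq> {1..M} - {a}" using D(2) by blast
      have "card (g ` D) = card ({1..M} - {a})"
        unfolding card_image[OF inj] using calculation ab by simp
      then show "{1..M} - {a} \<subseteq> g ` D"
        using card_subset_eq[OF _ \<open>g ` D \<subseteq> _\<close>] by simp
    qed
    moreover have "int (card D) = int M - 1" using calculation(1) ab by (auto simp: of_nat_diff)
    ultimately show ?thesis using main sumS[of "{a}"] sumS[of "{b}"] ab by simp
  next
    case False
    then obtain t where t: "opp (\<not> s, a) = (\<not> s, t)" by (auto simp: prod_eq_iff)
    have t1: "t \<in> {1..M}" "t \<noteq> a"
      using opp_in[OF va] opp_home[OF va] by (auto simp: t codes_def)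
    have ot: "opp (\<not> s, t) = (\<not> s, a)" using opp_opp[OF va] t by simp
    obtain f where f: "opp (s, b) = (s, f)"
    proof (cases "fst (opp (s, b)) = s")
      case True then show ?thesis using that[of "snd (opp (s, b))"] by (simp add: prod_eq_iff)
    next
      case False
      then obtain y where y: "opp (s, b) = (\<not> s, y)" by (auto simp: prod_eq_iff)
      have "y = a" using opp_in[OF vb] opp_home[OF vb] home_s home_t ab by (auto simp: y codes_def)
      then show ?thesis using opp_opp[OF vb] y t by simp
    qed
    have f1: "f \<in> {1..M}" "f \<noteq> b"
      using opp_in[OF vb] opp_home[OF vb] by (auto simp: f codes_def)
    have of: "opp (s, f) = (s, b)" using opp_opp[OF vb] f by simp
    have "D = {1..M} - {b, f}"
    proof -
      have "x = f" if x: "x \<in> {1..M}" "x \<noteq> b" "fst (opp (s, x)) = s" for x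
      proof -
        obtain y where y: "opp (s, x) = (s, y)" using x(3) by (auto simp: prod_eq_iff)
        have vx: "(s, x) \<in> codes M" using that by (simp add: codes_def)
        have "y = b" using opp_in[OF vx] opp_home[OF vx] that home_s by (auto simp: y codes_def)
        then show ?thesis using opp_opp[OF vx] y f by simp
      qed
      then have "{1..M} - {b, f} \<subseteq> D" by (force simp: D_def)
      moreover have "f \<notin> D" using of by (simp add: D_def)
      ultimately show ?thesis by (auto simp: D_def)
    qed
    moreover have c: "int (card D) = int M - 2"
    proof -
      have "card D = M - card {b, f}"
        unfolding calculation using ab f1 by (subst card_Diff_subset) auto
      moreover have "card {b, f} \<le> card {1..M}" using ab f1 by (intro card_mono) auto
      ultimately show ?thesis using f1 by (simp add: of_nat_diff)
    qed
    moreover have "g ` D = {1..M} - {a, t}"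
    proof (rule card_subset_eq)
      show "g ` D \<subseteq> {1..M} - {a, t}"
      proof
        fix p assume "p \<in> g ` D"
        then obtain q where q: "q \<in> D" "p = g q" by blast
        have "p \<noteq> t"
          using D(1)[OF q(1)] opp_opp[of "(s, q)"] D(3)[OF q(1)] ot q(2) by (auto simp: codes_def)
        then show "p \<in> {1..M} - {a, t}" using D(2)[OF q(1)] q(2) by simp
      qed
      have "card ({1..M} - {a, t}) = M - card {a, t}"
        using ab t1 by (subst card_Diff_subset) auto
      then show "card (g ` D) = card ({1..M} - {a, t})"
        using t1 c by (simp add: card_image[OF inj])
    qed simp
    ultimately have "2 * (int M - 2) - ((int b + int f) - (int a + int t))
        \<le> int (card {q \<in> {1..M}. opp (s, q) = (\<not> s, q + 1)})"
      using main sumS[of "{a, t}"] sumS[of "{b, f}"] ab t1 f1 by simp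
    \<comment> \<open>The unknown \<open>f - t\<close> is at most M - 1, which lowers 2(M - 2) to M
      - 3.\<close>
    then show ?thesis using t1 f1 by simp
  qed
qed


section \<open>Break offsets and counts of home games\<close>

text \<open>
  Rounds are counted cyclically from \<open>z\<close>, so that the D-sequence reads \<open>(1, 2, \<dots>, 2)\<close> and the
  breaks are at offset 0 and at the odd offsets.
\<close>
definition break_offsets :: "nat \<Rightarrow> nat set" where
  "break_offsets M = {k. k < 2 * M - 1 \<and> (k = 0 \<or> odd k)}"

lemma card_break_offsets:
  assumes "1 \<le> M" shows "card (break_offsets M) = M"
proof -
  have "break_offsets M = insert 0 ((\<lambda>j. 2 * j + 1) ` {..<M - 1})"
  proof (intro set_eqI iffI)
    fix k assume "k \<in> break_offsets M"
    then have "k < 2 * M - 1" "k = 0 \<or> (\<exists>j. k = 2 * j + 1)"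
      by (auto simp: break_offsets_def elim: oddE)
    then show "k \<in> insert 0 ((\<lambda>j. 2 * j + 1) ` {..<M - 1})" by auto
  qed (use assms in \<open>auto simp: break_offsets_def\<close>)
  moreover have "card ((\<lambda>j. 2 * j + 1) ` {..<M - 1}) = M - 1"
    by (subst card_image) (auto simp: inj_on_def)
  moreover have "0 \<notin> (\<lambda>j. 2 * j + 1) ` {..<M - 1}" by auto
  ultimately show ?thesis using assms by (simp only: card_insert_disjoint finite_imageI) auto
qed

text \<open>These are the offsets at which a team breaking at \<open>b\<close> repeats its venue of
  offset 0: the even ones before the break and the odd ones from it on. For b = 2c - 1 there are c
  of the former and M - c of the latter; for b = 0 all M even offsets count.\<close>

lemma card_break_pattern:
  assumes "b \<in> break_offsets M"
  shows "card {k. k < 2 * M - 1 \<and> even k = (k < b \<or> b = 0)} = M"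
proof -
  define c where "c = (if b = 0 then M else (b + 1) div 2)"
  have c: "b = 0 \<and> c = M \<or> b + 1 = 2 * c \<and> c < M"
    using assms by (auto simp: c_def break_offsets_def elim!: oddE)
  define f where "f j = (if j < c then 2 * j else 2 * j - 1)" for j
  have "{k. k < 2 * M - 1 \<and> even k = (k < b \<or> b = 0)} = f ` {..<M}"
  proof (intro set_eqI iffI)
    fix k assume k: "k \<in> {k. k < 2 * M - 1 \<and> even k = (k < b \<or> b = 0)}"
    show "k \<in> f ` {..<M}"
    proof (cases "even k")
      case True
      then obtain j where "k = 2 * j" by blast
      moreover have "j < c" using k True c calculation by auto
      ultimately show ?thesis using c by (intro image_eqI[of _ _ j]) (auto simp: f_def)
    next
      case False
      then obtain j where "k = 2 * j + 1" by (blast elim: oddE)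
      moreover have "\<not> j + 1 < c" "j + 1 < M" using k False c calculation by auto
      ultimately show ?thesis by (intro image_eqI[of _ _ "j + 1"]) (auto simp: f_def)
    qed
  next
    fix k assume "k \<in> f ` {..<M}"
    then obtain j where "j < M" "k = f j" by auto
    then show "k \<in> {k. k < 2 * M - 1 \<and> even k = (k < b \<or> b = 0)}"
      using c by (auto simp: f_def)
  qed
  moreover have "inj_on f {..<M}"
    using c by (intro inj_onI) (auto simp: f_def split: if_splits; presburger)
  ultimately show ?thesis by (simp add: card_image)
qed

lemma card_codes: "card (codes M) = 2 * M" and finite_codes: "finite (codes M)"
  by (simp_all add: codes_def card_cartesian_product card_UNIV_bool)

text \<open>Within its side, position p hosts the p - 1 lower positions; across, the weak comparison
  gives the True side one home game more. This excess later tells the sides apart.\<close>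

lemma card_beaten:
  assumes "(s, p) \<in> codes M"
  shows "card {w \<in> codes M. w \<noteq> (s, p) \<and> beats (s, p) w} = (if s then M else M - 1)"
proof (cases s)
  case True
  have "{w \<in> codes M. w \<noteq> (s, p) \<and> beats (s, p) w} = {True} \<times> {1..<p} \<union> {False} \<times> {p..M}"
    using assms True by (auto simp: codes_def beats_def split: if_splits)
  moreover have "card ({True} \<times> {1..<p} \<union> {False} \<times> {p..M}) = (p - 1) + (M + 1 - p)"
    by (subst card_Un_disjoint) (auto simp: card_cartesian_product)
  ultimately show ?thesis using assms True by (auto simp: codes_def)
next
  case False
  have "{w \<in> codes M. w \<noteq> (s, p) \<and> beats (s, p) w} = {False} \<times> {1..<p} \<union> {True} \<times> {p<..M}"
    using assms False by (auto simp: codes_def beats_def split: if_splits)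
  moreover have "card ({False} \<times> {1..<p} \<union> {True} \<times> {p<..M}) = (p - 1) + (M - p)"
    by (subst card_Un_disjoint) (auto simp: card_cartesian_product)
  ultimately show ?thesis using assms False by (auto simp: codes_def)
qed

section \<open>The coded schedule in rounds counted from \<open>z\<close>\<close>

text \<open>\<open>opp k v\<close> is the opponent of \<open>v\<close> at offset k, and
  \<open>br v\<close> the offset of its break. \<open>break_iff\<close> compares neighbouring
  offsets without wrapping around, so a team with \<open>br v = 0\<close> alternates
  throughout.\<close>

locale canonical_pattern =
  fixes M :: nat and opp :: "nat \<Rightarrow> code \<Rightarrow> code" and br :: "code \<Rightarrow> nat"
  assumes M_ge: "3 \<le> M"
    and opp_in: "\<And>k v. k < 2 * M - 1 \<Longrightarrow> v \<in> codes M \<Longrightarrow> opp k v \<in> codes M"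
    and opp_neq: "\<And>k v. k < 2 * M - 1 \<Longrightarrow> v \<in> codes M \<Longrightarrow> opp k v \<noteq> v"
    and opp_opp: "\<And>k v. k < 2 * M - 1 \<Longrightarrow> v \<in> codes M \<Longrightarrow> opp k (opp k v) = v"
    and opp_inj: "\<And>k l v. k < 2 * M - 1 \<Longrightarrow> l < 2 * M - 1 \<Longrightarrow> v \<in> codes M \<Longrightarrow>
      opp k v = opp l v \<Longrightarrow> k = l"
    and opp_surj: "\<And>v w. v \<in> codes M \<Longrightarrow> w \<in> codes M \<Longrightarrow> v \<noteq> w \<Longrightarrow>
      \<exists>k < 2 * M - 1. opp k v = w"
    and break_iff: "\<And>k v. Suc k < 2 * M - 1 \<Longrightarrow> v \<in> codes M \<Longrightarrow>
      (beats v (opp (Suc k) v) \<longleftrightarrow> beats v (opp k v)) \<longleftrightarrow> Suc k = br v"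
    and br_in: "\<And>v. v \<in> codes M \<Longrightarrow> br v \<in> break_offsets M"
    and br_surj: "\<And>k. k \<in> break_offsets M \<Longrightarrow> \<exists>v \<in> codes M. br v = k"
begin

definition home :: "nat \<Rightarrow> code \<Rightarrow> bool" where
  "home k v \<longleftrightarrow> beats v (opp k v)"

lemma home_opp:
  assumes "k < 2 * M - 1" "v \<in> codes M"
  shows "home k (opp k v) \<longleftrightarrow> \<not> home k v"
  using beats_asym[of v "opp k v"] opp_neq[OF assms] opp_opp[OF assms] by (auto simp: home_def)

text \<open>Before the break the even offsets repeat the first venue; the break flips the parity. A
  break at offset 0 acts like one that is never reached, hence the disjunct
  \<open>br v = 0\<close>.\<close>

lemma home_iff_home_0:
  assumes "v \<in> codes M" "k < 2 * M - 1"
  shows "home k v \<longleftrightarrow> (home 0 v \<longleftrightarrow> even k = (k < br v \<or> br v = 0))"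
  using assms(2)
proof (induction k)
  case (Suc k)
  have "(home (Suc k) v \<longleftrightarrow> home k v) \<longleftrightarrow> Suc k = br v"
    using break_iff[OF Suc.prems assms(1)] by (simp add: home_def)
  moreover have "home k v \<longleftrightarrow> (home 0 v \<longleftrightarrow> even k = (k < br v \<or> br v = 0))"
    using Suc by simp
  moreover have "k < br v \<longleftrightarrow> Suc k = br v \<or> Suc k < br v" by auto
  moreover have "Suc k = br v \<Longrightarrow> br v \<noteq> 0 \<and> \<not> Suc k < br v" by simp
  ultimately show ?case unfolding even_Suc by argo
qed auto

lemma card_home_rounds:
  assumes "(s, p) \<in> codes M"
  shows "card {k. k < 2 * M - 1 \<and> home k (s, p)} = (if s then M else M - 1)"
proof -
  let ?K = "{k. k < 2 * M - 1 \<and> home k (s, p)}"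
  have "inj_on (\<lambda>k. opp k (s, p)) ?K"
    using opp_inj assms by (auto intro: inj_onI)
  moreover have "(\<lambda>k. opp k (s, p)) ` ?K = {w \<in> codes M. w \<noteq> (s, p) \<and> beats (s, p) w}"
  proof (intro set_eqI iffI)
    fix w assume "w \<in> {w \<in> codes M. w \<noteq> (s, p) \<and> beats (s, p) w}"
    moreover then obtain k where "k < 2 * M - 1" "opp k (s, p) = w"
      using opp_surj[OF assms] by blast
    ultimately show "w \<in> (\<lambda>k. opp k (s, p)) ` ?K" by (auto simp: home_def)
  qed (use opp_in[OF _ assms] opp_neq[OF _ assms, THEN not_sym] in \<open>auto simp: home_def\<close>)
  ultimately show ?thesis using card_beaten[OF assms] card_image by fastforce
qed

text \<open>By \<open>card_break_pattern\<close> a team has M home games if it starts at home and M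
  - 1 if it starts away, wherever it breaks. The count forced by its side therefore fixes the
  start.\<close>

lemma home_0:
  assumes "(s, p) \<in> codes M" shows "home 0 (s, p) \<longleftrightarrow> s"
proof -
  let ?P = "{k. k < 2 * M - 1 \<and> even k = (k < br (s, p) \<or> br (s, p) = 0)}"
  have P: "card ?P = M" using card_break_pattern br_in assms by blast
  have "{k. k < 2 * M - 1 \<and> home k (s, p)} = (if home 0 (s, p) then ?P else {..<2 * M - 1} - ?P)"
    using home_iff_home_0[OF assms] by auto
  moreover have "card ({..<2 * M - 1} - ?P) = M - 1"
    using card_Diff_subset[of ?P "{..<2 * M - 1}"] unfolding P by auto
  ultimately have "(if home 0 (s, p) then M else M - 1) = (if s then M else M - 1)"
    using card_home_rounds[OF assms] P by (cases "home 0 (s, p)") simp_all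
  then show ?thesis using M_ge by (auto split: if_splits)
qed

lemma home_iff:
  assumes "(s, p) \<in> codes M" "k < 2 * M - 1"
  shows "home k (s, p) \<longleftrightarrow> (s \<longleftrightarrow> even k = (k < br (s, p) \<or> br (s, p) = 0))"
  using home_iff_home_0[OF assms] home_0[OF assms(1)] by simp

lemma card_home_teams:
  assumes "k < 2 * M - 1" shows "card {v \<in> codes M. home k v} = M"
proof -
  let ?X = "{v \<in> codes M. home k v}" and ?Y = "{v \<in> codes M. \<not> home k v}"
  have "bij_betw (opp k) ?X ?Y"
    by (rule bij_betw_byWitness[of _ "opp k"])
      (use assms opp_in opp_opp home_opp in auto)
  then have "card ?X = card ?Y" by (rule bij_betw_same_card)
  moreover have "card ?X + card ?Y = card (?X \<union> ?Y)"
    using finite_codes[of M] by (subst card_Un_disjoint) auto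
  moreover have "?X \<union> ?Y = codes M" by auto
  ultimately show ?thesis using card_codes[of M] by simp
qed

text \<open>
  In each round the home teams are the late ones of one side and the others of the other side.
  As they number \<open>M\<close>, both sides have equally many late teams.
\<close>
definition late :: "nat \<Rightarrow> bool \<Rightarrow> nat set" where
  "late k s = {p \<in> {1..M}. k < br (s, p) \<or> br (s, p) = 0}"

lemma card_late:
  assumes k: "k < 2 * M - 1" shows "card (late k True) = card (late k False)"
proof -
  let ?h = "\<lambda>s. {p \<in> {1..M}. home k (s, p)}"
  have "{v \<in> codes M. home k v} = {True} \<times> ?h True \<union> {False} \<times> ?h False"
  proof (intro set_eqI)
    fix v :: code
    show "v \<in> {v \<in> codes M. home k v} \<longleftrightarrow> v \<in> {True} \<times> ?h True \<union> {False} \<times> ?h False"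
      by (cases v; cases "fst v") (auto simp: codes_def)
  qed
  moreover have "card ({True} \<times> ?h True \<union> {False} \<times> ?h False) = card (?h True) + card (?h False)"
    by (subst card_Un_disjoint) (auto simp: card_cartesian_product)
  ultimately have sum: "card (?h True) + card (?h False) = M"
    using card_home_teams[OF k] by simp
  have h: "?h s = (if s = even k then late k s else {1..M} - late k s)" for s
    using home_iff[OF _ k, of s] by (auto simp: late_def codes_def)
  have sub: "late k s \<subseteq> {1..M}" for s by (auto simp: late_def)
  have "card ({1..M} - late k s) + card (late k s) = M" for s
    using card_mono[OF _ sub[of s]] card_Diff_subset[OF _ sub[of s]] finite_subset[OF sub[of s]]
    by simp
  from this[of True] this[of False] sum show ?thesis
    unfolding h by (cases "even k") simp_all
qed

text \<open>The teams breaking at k > 0 are those that cease to be late there, and late teams are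
  equally many on both sides. For k = 0 they are the ones still late at the last offset, all other
  breaks having occurred.\<close>

lemma card_breaking:
  assumes "k \<in> break_offsets M"
  shows "card {p \<in> {1..M}. br (True, p) = k} = card {p \<in> {1..M}. br (False, p) = k}"
proof (cases "k = 0")
  case True
  have "late (2 * M - 2) s = {p \<in> {1..M}. br (s, p) = k}" for s
    using br_in[of "(s, _)"] True by (force simp: late_def codes_def break_offsets_def)
  with card_late[of "2 * M - 2"] M_ge show ?thesis by simp
next
  case False
  have k: "k < 2 * M - 1" using assms by (simp add: break_offsets_def)
  have "card (late (k - 1) s) = card (late k s) + card {p \<in> {1..M}. br (s, p) = k}" for s
  proof -
    have "late (k - 1) s = late k s \<union> {p \<in> {1..M}. br (s, p) = k}"
      using False by (auto simp: late_def)
    moreover have "late k s \<inter> {p \<in> {1..M}. br (s, p) = k} = {}" "finite (late k s)"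
      using False by (auto simp: late_def)
    ultimately show ?thesis by (simp only:) (rule card_Un_disjoint; simp)
  qed
  from this[of True] this[of False] card_late[of k] card_late[of "k - 1"] k show ?thesis by simp
qed

text \<open>By \<open>card_breaking\<close> a break offset attained on one side is attained on the
  other. So on each side M teams map onto M offsets, hence injectively.\<close>

lemma unique_breaking:
  assumes "k \<in> break_offsets M"
  obtains p where "p \<in> {1..M}" "\<And>q. q \<in> {1..M} \<Longrightarrow> br (s, q) = k \<longleftrightarrow> q = p"
proof -
  let ?f = "\<lambda>p. br (s, p)"
  have surj: "\<exists>p \<in> {1..M}. br (s, p) = l" if l: "l \<in> break_offsets M" for l
  proof -
    obtain s' p where "(s', p) \<in> codes M" "br (s', p) = l" using br_surj[OF l] by auto
    then have "{p \<in> {1..M}. br (s', p) = l} \<noteq> {}" by (auto simp: codes_def)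
    then have "card {p \<in> {1..M}. br (s', p) = l} \<noteq> 0" by simp
    then have "card {p \<in> {1..M}. br (s, p) = l} \<noteq> 0"
      using card_breaking[OF l] by (cases s; cases s') simp_all
    then have "{p \<in> {1..M}. br (s, p) = l} \<noteq> {}" by (metis card.empty)
    then show ?thesis by blast
  qed
  have "?f ` {1..M} = break_offsets M"
    using surj br_in by (auto simp: codes_def)
  then have "inj_on ?f {1..M}"
    using card_break_offsets[of M] M_ge by (intro eq_card_imp_inj_on) auto
  then show thesis using surj[OF assms] that by (metis inj_onD)
qed

text \<open>At offset 0 the whole True side is at home, so it plays only across, against positions
  at least its own; \<open>inflating_injection_is_id\<close> leaves only equality.\<close>

lemma opp_0:
  assumes "p \<in> {1..M}" shows "opp 0 (True, p) = (False, p)"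
proof -
  have 0: "0 < 2 * M - 1" using M_ge by simp
  have opp: "opp 0 (True, q) = (False, snd (opp 0 (True, q)))"
    "q \<le> snd (opp 0 (True, q)) \<and> snd (opp 0 (True, q)) \<le> M" if q: "q \<in> {1..M}" for q
  proof -
    have v: "(True, q) \<in> codes M" using q by (simp add: codes_def)
    obtain t r where o: "opp 0 (True, q) = (t, r)" by fastforce
    have r: "(t, r) \<in> codes M" using opp_in[OF 0 v] o by simp
    have "\<not> t" using home_0[OF v] home_0[OF r] home_opp[OF 0 v] o by simp
    moreover have "q \<le> r"
      using home_0[OF v] \<open>\<not> t\<close> o by (simp add: home_def beats_def)
    ultimately show "opp 0 (True, q) = (False, snd (opp 0 (True, q)))"
      "q \<le> snd (opp 0 (True, q)) \<and> snd (opp 0 (True, q)) \<le> M"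
      using o r by (auto simp: codes_def)
  qed
  have "inj_on (\<lambda>q. snd (opp 0 (True, q))) {1..M}"
  proof (rule inj_onI)
    fix x y assume xy: "x \<in> {1..M}" "y \<in> {1..M}" "snd (opp 0 (True, x)) = snd (opp 0 (True, y))"
    then have "opp 0 (opp 0 (True, x)) = opp 0 (opp 0 (True, y))"
      using opp(1) by metis
    then show "x = y" using opp_opp[OF 0] xy by (simp add: codes_def)
  qed
  from inflating_injection_is_id[OF this opp(2) assms] opp(1)[OF assms] show ?thesis by simp
qed

section \<open>Counting the cross games of difference 1\<close>

definition tight :: "nat \<Rightarrow> bool \<Rightarrow> nat set" where
  "tight k s = {q \<in> {1..M}. opp k (s, q) = (\<not> s, q + 1)}"

text \<open>By \<open>opp_0\<close> the games between equal positions are used up at offset 0. Later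
  on the weak comparison in \<open>beats\<close> is thus strict, as \<open>near_round\<close>
  requires.\<close>

lemma card_tight:
  assumes k: "0 < k" "k < 2 * M - 1"
    and home_s: "\<And>q. q \<in> {1..M} \<Longrightarrow> home k (s, q) \<longleftrightarrow> q \<noteq> b"
    and home_t: "\<And>q. q \<in> {1..M} \<Longrightarrow> home k (\<not> s, q) \<longleftrightarrow> q = a"
    and ab: "a \<in> {1..M}" "b \<in> {1..M}"
  shows "int M - 3 - (int b - int a) \<le> int (card (tight k s))"
  unfolding tight_def
proof (rule near_round[where home = "home k"])
  fix p q assume q: "q \<in> {1..M}" and h: "home k (s, q)" and o: "opp k (s, q) = (\<not> s, p)"
  have v: "(s, q) \<in> codes M" using q by (simp add: codes_def)
  have 0: "0 < 2 * M - 1" using M_ge by simp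
  have "opp 0 (s, q) = (\<not> s, q)"
    using opp_0[OF q] opp_opp[OF 0, of "(True, q)"] q by (cases s) (auto simp: codes_def)
  then have "p \<noteq> q" using opp_inj[OF k(2) 0 v] o k by auto
  then show "q < p" using h o by (auto simp: home_def beats_def split: if_splits)
qed (use k opp_in opp_opp home_opp home_s home_t ab in auto)

text \<open>No game is played twice, so the two sets are disjoint, and position M has no partner M +
  1.\<close>

lemma card_tight_pair:
  assumes "k < 2 * M - 1" "l < 2 * M - 1" "k \<noteq> l"
  shows "card (tight k s) + card (tight l s) \<le> M - 1"
proof -
  have "tight k s \<inter> tight l s = {}"
  proof (rule ccontr)
    assume "tight k s \<inter> tight l s \<noteq> {}"
    then obtain q where "q \<in> tight k s" "q \<in> tight l s" by blast
    then have "(s, q) \<in> codes M" "opp k (s, q) = opp l (s, q)"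
      by (auto simp: tight_def codes_def)
    with opp_inj assms show False by blast
  qed
  then have "card (tight k s) + card (tight l s) = card (tight k s \<union> tight l s)"
    by (subst card_Un_disjoint) (auto simp: tight_def)
  also have "\<dots> \<le> card {1..M - 1}"
  proof (rule card_mono)
    show "tight k s \<union> tight l s \<subseteq> {1..M - 1}"
      using opp_in[OF assms(1), of "(s, _)"] opp_in[OF assms(2), of "(s, _)"]
      by (force simp: tight_def codes_def)
  qed simp
  finally show ?thesis by simp
qed

text \<open>Both rounds have the same exceptional teams, \<open>x\<close> and \<open>y\<close>, but
  with the sides exchanged, so the unknown terms \<open>y - x\<close> and \<open>x - y\<close>
  cancel.\<close>

lemma card_tight_two_rounds:
  assumes b: "b \<in> break_offsets M" and k: "0 < k" "k < 2 * M - 1" "0 < l" "l < 2 * M - 1"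
    and home_k: "\<And>s p. (s, p) \<in> codes M \<Longrightarrow> home k (s, p) \<longleftrightarrow> (s \<longleftrightarrow> br (s, p) = b)"
    and home_l: "\<And>s p. (s, p) \<in> codes M \<Longrightarrow> home l (s, p) \<longleftrightarrow> (s \<longleftrightarrow> br (s, p) \<noteq> b)"
  shows "2 * (int M - 3) \<le> int (card (tight k False)) + int (card (tight l True))"
proof -
  obtain x where x: "x \<in> {1..M}" "\<And>q. q \<in> {1..M} \<Longrightarrow> br (True, q) = b \<longleftrightarrow> q = x"
    using unique_breaking[OF b] by blast
  obtain y where y: "y \<in> {1..M}" "\<And>q. q \<in> {1..M} \<Longrightarrow> br (False, q) = b \<longleftrightarrow> q = y"
    using unique_breaking[OF b] by blast
  have "int M - 3 - (int y - int x) \<le> int (card (tight k False))"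
    by (rule card_tight[OF k(1,2)]) (use home_k x y in \<open>auto simp: codes_def\<close>)
  moreover have "int M - 3 - (int x - int y) \<le> int (card (tight l True))"
    by (rule card_tight[OF k(3,4)]) (use home_l x y in \<open>auto simp: codes_def\<close>)
  ultimately show ?thesis by simp
qed

theorem M_le_5: "M \<le> 5"
proof -
  have br: "br v < 2 * M - 2" "br v = 0 \<or> odd (br v)" if "v \<in> codes M" for v
  proof -
    have "br v < 2 * M - 1 \<and> (br v = 0 \<or> odd (br v))"
      using br_in[OF that] by (simp add: break_offsets_def)
    then show "br v < 2 * M - 2" "br v = 0 \<or> odd (br v)" using M_ge by presburger+
  qed
  \<comment> \<open>Teams with break offset 0 count as late, so up to offset 2 only those breaking
    at offset 1 have ceased to be late: one on each side.\<close>
  have "2 * (int M - 3) \<le> int (card (tight 1 False)) + int (card (tight 2 True))"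
  proof (rule card_tight_two_rounds[where b = 1])
    fix s p assume v: "(s, p) \<in> codes M"
    show "home 1 (s, p) \<longleftrightarrow> (s \<longleftrightarrow> br (s, p) = 1)"
      using home_iff[OF v, of 1] M_ge by auto
    have "2 < br (s, p) \<or> br (s, p) = 0 \<longleftrightarrow> br (s, p) \<noteq> 1"
      using br(2)[OF v] by (auto elim!: oddE)
    then show "home 2 (s, p) \<longleftrightarrow> (s \<longleftrightarrow> br (s, p) \<noteq> 1)"
      using home_iff[OF v, of 2] M_ge by auto
  qed (use M_ge in \<open>auto simp: break_offsets_def\<close>)
  \<comment> \<open>These are the last two offsets. The latest possible break is at 2M - 3, so only
    the teams with break offset 0 are still late.\<close>
  moreover have "2 * (int M - 3) \<le>
    int (card (tight (2 * M - 2) False)) + int (card (tight (2 * M - 3) True))"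
  proof (rule card_tight_two_rounds[where b = 0])
    fix s p assume v: "(s, p) \<in> codes M"
    show "home (2 * M - 2) (s, p) \<longleftrightarrow> (s \<longleftrightarrow> br (s, p) = 0)"
      using home_iff[OF v, of "2 * M - 2"] M_ge br(1)[OF v] by auto
    show "home (2 * M - 3) (s, p) \<longleftrightarrow> (s \<longleftrightarrow> br (s, p) \<noteq> 0)"
      using home_iff[OF v, of "2 * M - 3"] M_ge br(1)[OF v] by auto
  qed (use M_ge in \<open>auto simp: break_offsets_def\<close>)
  \<comment> \<open>Rounds with the same hosting side are paired, since they draw on the same M - 1
    games.\<close>
  moreover have "card (tight 1 False) + card (tight (2 * M - 2) False) \<le> M - 1"
    "card (tight 2 True) + card (tight (2 * M - 3) True) \<le> M - 1"
    using M_ge by (intro card_tight_pair; simp)+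
  ultimately show ?thesis by presburger
qed

end

section \<open>Venues forced by ranking-fairness\<close>

lemma ranked_opponent_eq:
  assumes "i \<in> teams n" "1 \<le> m" "m < n"
  shows "ranked_opponent n i m = (if m < i then m else m + 1)"
proof -
  have "teams n - {i} = set ([1..<i] @ [i + 1..<n + 1])"
    using assms(1) by (auto simp: teams_def)
  moreover have "sorted ([1..<i] @ [i + 1..<n + 1])" "distinct ([1..<i] @ [i + 1..<n + 1])"
    by (auto simp: sorted_append)
  ultimately have "sorted_list_of_set (teams n - {i}) = [1..<i] @ [i + 1..<n + 1]"
    by (metis sorted_list_of_set.idem_if_sorted_distinct)
  then show ?thesis
    using assms by (auto simp: ranked_opponent_def nth_append teams_def simp del: upt_Suc)
qed

text \<open>Alternation fixes the venues of team i up to one bit, \<open>e i\<close>. For i < j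
  their game is number j - 1 for i and number i for j; both views must name the same host, which
  forces \<open>e i = e j\<close>.\<close>

lemma ranking_fair_host:
  assumes sched: "is_schedule n S" and fair: "ranking_fair n S"
  obtains c where "\<And>i j. i \<in> teams n \<Longrightarrow> j \<in> teams n \<Longrightarrow> i < j \<Longrightarrow>
    host S {i, j} = i \<longleftrightarrow> (c \<longleftrightarrow> even (i + j))"
proof -
  define h where "h i m \<longleftrightarrow> ranking_hap n S i m = H" for i m
  have h_odd: "h i m \<longleftrightarrow> (h i 1 \<longleftrightarrow> odd m)" if i: "i \<in> teams n" and m: "1 \<le> m" "m < n" for i m
    using m
  proof (induction m rule: dec_induct)
    case (step m)
    have "ranking_hap n S i m \<noteq> ranking_hap n S i (m + 1)"
      using fair i step by (auto simp: ranking_fair_def)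
    then have "h i (Suc m) \<longleftrightarrow> \<not> h i m"
      unfolding h_def by (cases "ranking_hap n S i m"; cases "ranking_hap n S i (m + 1)") auto
    with step show ?case by auto
  qed simp
  define e where "e i \<longleftrightarrow> (h i 1 \<longleftrightarrow> even i)" for i
  have host_i: "host S {i, j} = i \<longleftrightarrow> (e i \<longleftrightarrow> even (i + j))" and ee: "e i \<longleftrightarrow> e j"
    if ij: "i \<in> teams n" "j \<in> teams n" "i < j" for i j
  proof -
    have "{i, j} \<in> pairings n" using ij by (auto simp: pairings_def)
    then have "host S {i, j} \<in> {i, j}" using sched by (metis is_schedule_def)
    then have other: "host S {i, j} = j \<longleftrightarrow> host S {i, j} \<noteq> i" using ij by auto
    have "h i (j - 1) \<longleftrightarrow> host S {i, j} = i"
      using ij ranked_opponent_eq[of i n "j - 1"]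
      by (auto simp: h_def ranking_hap_def venue_in_def teams_def)
    moreover have "h j i \<longleftrightarrow> host S {i, j} = j"
      using ij ranked_opponent_eq[of j n i]
      by (auto simp: h_def ranking_hap_def venue_in_def teams_def insert_commute)
    moreover have "h i (j - 1) \<longleftrightarrow> (h i 1 \<longleftrightarrow> even j)"
      using h_odd[of i "j - 1"] ij by (auto simp: teams_def)
    moreover have "h j i \<longleftrightarrow> (h j 1 \<longleftrightarrow> odd i)"
      using h_odd[of j i] ij by (auto simp: teams_def)
    ultimately show "host S {i, j} = i \<longleftrightarrow> (e i \<longleftrightarrow> even (i + j))" "e i \<longleftrightarrow> e j"
      using other unfolding e_def even_add by argo+
  qed
  have "e i \<longleftrightarrow> e 1" if "i \<in> teams n" for i
    using ee[of 1 i] that by (cases "i = 1") (auto simp: teams_def)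
  with host_i show thesis by (intro that[of "e 1"]) metis
qed

text \<open>
  When \<open>c\<close> holds, reversing the ranking brings the venues into the form of \<open>beats\<close>.
\<close>
fun team :: "bool \<Rightarrow> nat \<Rightarrow> code \<Rightarrow> nat" where
  "team c M (s, p) = (let i = if s then 2 * p - 1 else 2 * p in if c then 2 * M + 1 - i else i)"

lemma even_team:
  assumes "(s, p) \<in> codes M" shows "even (team c M (s, p)) \<longleftrightarrow> s = c"
  using assms by (cases c; cases s) (auto simp: codes_def Let_def)

lemma team_bij: "bij_betw (team c M) (codes M) (teams (2 * M))"
  unfolding bij_betw_def
proof
  show inj: "inj_on (team c M) (codes M)"
  proof (rule inj_onI)
    fix v w assume "v \<in> codes M" "w \<in> codes M" "team c M v = team c M w"
    then show "v = w"
      by (cases v; cases w) (auto simp: codes_def Let_def split: if_splits; presburger)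
  qed
  show "team c M ` codes M = teams (2 * M)"
  proof (rule card_subset_eq)
    show "team c M ` codes M \<subseteq> teams (2 * M)"
      by (auto simp: codes_def teams_def Let_def)
    show "card (team c M ` codes M) = card (teams (2 * M))"
      by (simp add: card_image[OF inj] card_codes teams_def)
  qed (simp add: teams_def)
qed

lemma host_team:
  assumes sched: "is_schedule (2 * M) S"
    and host: "\<And>i j. i \<in> teams (2 * M) \<Longrightarrow> j \<in> teams (2 * M) \<Longrightarrow> i < j \<Longrightarrow>
      host S {i, j} = i \<longleftrightarrow> (c \<longleftrightarrow> even (i + j))"
    and v: "v \<in> codes M" and w: "w \<in> codes M" and "v \<noteq> w"
  shows "host S {team c M v, team c M w} = team c M v \<longleftrightarrow> beats v w"
proof -
  have mem: "team c M v \<in> teams (2 * M)" "team c M w \<in> teams (2 * M)"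
    using team_bij[of c M] v w by (auto simp: bij_betw_def)
  have neq: "team c M v \<noteq> team c M w"
    using team_bij[of c M] v w \<open>v \<noteq> w\<close> by (auto simp: bij_betw_def inj_on_def)
  have "{team c M v, team c M w} \<in> pairings (2 * M)" using mem neq by (auto simp: pairings_def)
  then have "host S {team c M v, team c M w} \<in> {team c M v, team c M w}"
    using sched by (metis is_schedule_def)
  \<comment> \<open>The hypothesis speaks of the smaller index; if that belongs to \<open>w\<close>,
    negation yields the same formula for \<open>v\<close>.\<close>
  then have "host S {team c M v, team c M w} = team c M v \<longleftrightarrow>
      ((c \<longleftrightarrow> even (team c M v + team c M w)) \<longleftrightarrow> team c M v < team c M w)"
    using host[OF mem] host[OF mem(2) mem(1)] neq
    by (cases "team c M v < team c M w") (auto simp: insert_commute add.commute)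
  moreover have "((c \<longleftrightarrow> even (team c M v + team c M w)) \<longleftrightarrow> team c M v < team c M w) \<longleftrightarrow> beats v w"
  proof -
    obtain s p t q where vw: "v = (s, p)" "w = (t, q)" by (cases v; cases w) auto
    then have bounds: "1 \<le> p" "p \<le> M" "1 \<le> q" "q \<le> M" using v w by (auto simp: codes_def)
    have pq: "p \<noteq> q" if "s = t" using \<open>v \<noteq> w\<close> vw that by simp
    \<comment> \<open>The inner condition is the interleaved order of the codes, which
      \<open>c\<close> reverses.\<close>
    have less: "team c M v < team c M w \<longleftrightarrow>
        (c \<longleftrightarrow> \<not> (if s = t then p < q else if s then p \<le> q else p < q))"
      using bounds pq unfolding vw by (cases c; cases s; cases t) (simp_all add: Let_def; linarith)+
    have "even (team c M v + team c M w) \<longleftrightarrow> s = t"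
      using even_team[of s p M c] even_team[of t q M c] v w by (auto simp: vw)
    moreover have "beats v w \<longleftrightarrow> (if s = t then q < p else if s then p \<le> q else p < q)"
      by (simp add: vw beats_def)
    ultimately show ?thesis
      unfolding less using pq by (cases c; cases s; cases t) auto
  qed
  ultimately show ?thesis by simp
qed

section \<open>From the D-sequence to the break rounds\<close>

text \<open>Rotation moves the single 1 cyclically among the 2s and reversal mirrors its place, so
  both alternatives give the same family of lists.\<close>

lemma d_sequence_shape:
  assumes "d = rotate k (canonical_d_sequence (2 * M)) \<or>
      d = rev (rotate k (canonical_d_sequence (2 * M)))" and "1 \<le> M"
  obtains a b where "d = replicate a 2 @ 1 # replicate b 2" "a + b + 1 = M"
proof -
  have "\<exists>a b. rotate k (canonical_d_sequence (2 * M)) = replicate a 2 @ 1 # replicate b 2 \<and>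
      a + b + 1 = M"
  proof (induction k)
    case 0
    then show ?case
      using assms(2) by (intro exI[of _ "M - 1"] exI[of _ 0]) (simp add: canonical_d_sequence_def)
  next
    case (Suc k)
    then obtain a b where
      ab: "rotate k (canonical_d_sequence (2 * M)) = replicate a 2 @ 1 # replicate b 2"
      "a + b + 1 = M" by blast
    show ?case
    proof (cases a)
      case 0
      then show ?thesis using ab by (intro exI[of _ b] exI[of _ 0]) simp
    next
      case (Suc a')
      then show ?thesis using ab
        by (intro exI[of _ a'] exI[of _ "Suc b"]) (simp add: replicate_append_same)
    qed
  qed
  then obtain a b where
    ab: "rotate k (canonical_d_sequence (2 * M)) = replicate a 2 @ 1 # replicate b 2" "a + b + 1 = M"
    by blast
  then have "rev (rotate k (canonical_d_sequence (2 * M))) = replicate b 2 @ 1 # replicate a 2"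
    by simp
  with ab assms(1) show thesis using that[of a b] that[of b a] by auto
qed

definition cyclic_round :: "nat \<Rightarrow> nat \<Rightarrow> nat \<Rightarrow> nat" where
  "cyclic_round n z k = (if z + k < n then z + k else z + k - (n - 1))"

lemma cyclic_round_bij:
  assumes "z \<in> rounds n"
  shows "bij_betw (cyclic_round n z) {..<n - 1} (rounds n)"
  unfolding bij_betw_def
proof
  show inj: "inj_on (cyclic_round n z) {..<n - 1}"
    by (rule inj_onI) (use assms in \<open>auto simp: cyclic_round_def rounds_def split: if_splits\<close>)
  show "cyclic_round n z ` {..<n - 1} = rounds n"
  proof (rule card_subset_eq)
    show "cyclic_round n z ` {..<n - 1} \<subseteq> rounds n"
      using assms by (auto simp: cyclic_round_def rounds_def)
    show "card (cyclic_round n z ` {..<n - 1}) = card (rounds n)"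
      unfolding card_image[OF inj] by (simp add: rounds_def)
  qed (simp add: rounds_def)
qed

lemma prev_cyclic_round:
  assumes "z \<in> rounds n" "Suc k < n - 1"
  shows "prev_round n (cyclic_round n z (Suc k)) = cyclic_round n z k"
  using assms by (auto simp: prev_round_def cyclic_round_def rounds_def)

lemma canonical_break_rounds:
  fixes n S
  defines "BR \<equiv> \<Union>i \<in> teams n. breaks n S i"
  assumes n: "n = 2 * M" "1 \<le> M"
    and d: "d_sequence n S = rotate k (canonical_d_sequence n) \<or>
      d_sequence n S = rev (rotate k (canonical_d_sequence n))"
  obtains z where "z \<in> rounds n"
    "\<And>k. k < n - 1 \<Longrightarrow> cyclic_round n z k \<in> BR \<longleftrightarrow> k \<in> break_offsets M"
proof -
  define rs where "rs = break_rounds n S"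
  have BR: "BR \<subseteq> rounds n" by (auto simp: BR_def breaks_def)
  then have "finite BR" by (rule finite_subset) (simp add: rounds_def)
  then have set_rs: "set rs = BR" by (simp add: rs_def break_rounds_def BR_def)
  obtain a b where ab: "d_sequence n S = replicate a 2 @ 1 # replicate b 2" "a + b + 1 = M"
    using d_sequence_shape[of "d_sequence n S" k M] d n by blast
  have "length (d_sequence n S) = length rs" by (simp add: d_sequence_def rs_def Let_def)
  then have len: "length rs = M" using ab by simp
  have gap: "(if j + 1 < M then rs ! (j + 1) else rs ! 0 + (n - 1)) - rs ! j = (if j = a then 1 else 2)"
    if "j < M" for j
  proof -
    have "d_sequence n S ! j = (if j + 1 < M then rs ! (j + 1) else rs ! 0 + (n - 1)) - rs ! j"
      using that len by (simp add: d_sequence_def rs_def[symmetric] Let_def)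
    moreover have "d_sequence n S ! j = (if j = a then 1 else 2)"
      using ab that by (auto simp: nth_append nth_Cons')
    ultimately show ?thesis by simp
  qed
  have rs: "rs ! j = (if j \<le> a then rs ! 0 + 2 * j else rs ! 0 + 2 * j - 1)" if "j < M" for j
    using that
  proof (induction j)
    case (Suc j)
    then show ?case using gap[of j] by (auto split: if_splits)
  qed simp
  have range: "1 \<le> rs ! j \<and> rs ! j < n" if "j < M" for j
  proof -
    have "rs ! j \<in> rounds n" using that nth_mem[of j rs] len set_rs BR by blast
    then show ?thesis using n by (auto simp: rounds_def)
  qed
  \<comment> \<open>The gap 1 starts at index \<open>a\<close>, so counting from here turns the
    D-sequence into (1, 2, ..., 2).\<close>
  define z where "z = rs ! a"
  have z: "z \<in> rounds n" using range[of a] ab by (auto simp: z_def rounds_def)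
  have z_eq: "z = rs ! 0 + 2 * a" using rs[of a] ab by (simp add: z_def)
  \<comment> \<open>The M breaks span almost all rounds, so the first is in round 1 or 2, and in
    round 1 if the gap 1 is the one that wraps around. This decides below which offsets
    wrap.\<close>
  have r0: "1 \<le> rs ! 0" "rs ! 0 \<le> (if a + 1 = M then 1 else 2)"
    using range[of 0] range[of "M - 1"] rs[of "M - 1"] ab n by (auto split: if_splits)
  have "cyclic_round n z l \<in> BR \<longleftrightarrow> l \<in> break_offsets M" if l: "l < n - 1" for l
  proof
    assume "cyclic_round n z l \<in> BR"
    then obtain j where "j < M" "cyclic_round n z l = rs ! j"
      using set_rs len by (auto simp: in_set_conv_nth)
    \<comment> \<open>The cases are the break at \<open>z\<close>, one reached before the wrap, and
      one reached after it.\<close>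
    then have "l = 0 \<or> l + 1 = 2 * (j - a) \<or> l + 1 = 2 * (M + j - a)"
      using rs[of j] z_eq r0 l n(1) by (auto simp: cyclic_round_def split: if_splits)
    then have "l = 0 \<or> odd l" by (metis dvd_triv_left even_plus_one_iff)
    then show "l \<in> break_offsets M" using l n by (simp add: break_offsets_def)
  next
    assume "l \<in> break_offsets M"
    then consider "l = 0" | i where "l = 2 * i + 1" by (auto simp: break_offsets_def elim: oddE)
    then have "\<exists>j < M. cyclic_round n z l = rs ! j"
    proof cases
      case 1
      then show ?thesis using z ab by (intro exI[of _ a]) (auto simp: cyclic_round_def z_def rounds_def)
    next
      \<comment> \<open>Offset 2i + 1 belongs to the break of index a + i + 1, reduced by M after
        the wrap.\<close>
      case (2 i)
      show ?thesis
      proof (cases "z + l < n")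
        case True
        then have "a + i + 1 < M" using 2 z_eq r0 n by auto
        then show ?thesis using True rs[of "a + i + 1"] 2 z_eq
          by (intro exI[of _ "a + i + 1"]) (simp add: cyclic_round_def)
      next
        case False
        have "M \<le> a + i + 1" using False 2 z_eq r0 n ab l by (auto split: if_splits)
        moreover have "a + i + 1 - M \<le> a" using 2 l n by auto
        ultimately show ?thesis using False rs[of "a + i + 1 - M"] 2 z_eq n ab
          by (intro exI[of _ "a + i + 1 - M"]) (simp add: cyclic_round_def)
      qed
    qed
    then show "cyclic_round n z l \<in> BR" using set_rs len nth_mem by metis
  qed
  with z show thesis by (rule that)
qed

section \<open>Transfer of a schedule to the coded form\<close>

theorem theorem3:
  fixes n :: nat
  assumes "n \<ge> 12" and "even n"
  shows "\<not> (\<exists>S. is_schedule n S \<and> feasible n S \<and> single_break n S \<and> ranking_fair n S \<and>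
    (\<exists>k. d_sequence n S = rotate k (canonical_d_sequence n) \<or>
         d_sequence n S = rev (rotate k (canonical_d_sequence n))))"
proof
  assume "\<exists>S. is_schedule n S \<and> feasible n S \<and> single_break n S \<and> ranking_fair n S \<and>
    (\<exists>k. d_sequence n S = rotate k (canonical_d_sequence n) \<or>
         d_sequence n S = rev (rotate k (canonical_d_sequence n)))"
  then obtain S k where sched: "is_schedule n S" and feas: "feasible n S"
    and single: "single_break n S" and fair: "ranking_fair n S"
    and d: "d_sequence n S = rotate k (canonical_d_sequence n) \<or>
      d_sequence n S = rev (rotate k (canonical_d_sequence n))"
    by blast
  obtain M where n: "n = 2 * M" using assms(2) by blast
  obtain c where c: "\<And>i j. i \<in> teams n \<Longrightarrow> j \<in> teams n \<Longrightarrow> i < j \<Longrightarrow>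
    host S {i, j} = i \<longleftrightarrow> (c \<longleftrightarrow> even (i + j))"
    using ranking_fair_host[OF sched fair] by blast
  obtain z where z: "z \<in> rounds n" and z_iff: "\<And>k. k < n - 1 \<Longrightarrow>
      cyclic_round n z k \<in> (\<Union>i \<in> teams n. breaks n S i) \<longleftrightarrow> k \<in> break_offsets M"
    using canonical_break_rounds[OF n _ d] assms n by auto
  define \<tau> where "\<tau> = team c M"
  define \<rho> where "\<rho> = cyclic_round n z"
  have \<rho>: "bij_betw \<rho> {..<n - 1} (rounds n)"
    unfolding \<rho>_def by (rule cyclic_round_bij[OF z])
  have \<tau>: "bij_betw \<tau> (codes M) (teams n)"
    unfolding \<tau>_def n by (rule team_bij)
  have \<rho>_in: "\<rho> k \<in> rounds n" if "k < n - 1" for k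
    using \<rho> that by (auto simp: bij_betw_def)
  have \<rho>_inj: "k = l" if "k < n - 1" "l < n - 1" "\<rho> k = \<rho> l" for k l
    using \<rho> that by (auto simp: bij_betw_def inj_on_def)
  have \<rho>_surj: "\<exists>k < n - 1. \<rho> k = r" if "r \<in> rounds n" for r
    using \<rho> that by (force simp: bij_betw_def)
  have \<tau>_in: "\<tau> v \<in> teams n" if "v \<in> codes M" for v
    using \<tau> that by (auto simp: bij_betw_def)
  have \<tau>_inj: "\<tau> v = \<tau> w \<longleftrightarrow> v = w" if "v \<in> codes M" "w \<in> codes M" for v w
    using \<tau> that by (auto simp: bij_betw_def inj_on_def)
  have \<tau>_surj: "\<exists>v \<in> codes M. \<tau> v = i" if "i \<in> teams n" for i
    using \<tau> that by (force simp: bij_betw_def)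
  have pair: "{\<tau> v, \<tau> w} \<in> pairings n" if "v \<in> codes M" "w \<in> codes M" "v \<noteq> w" for v w
    using \<tau>_in \<tau>_inj that by (auto simp: pairings_def)
  have unique_game: "\<exists>!e. e \<in> pairings n \<and> \<tau> v \<in> e \<and> game_round S e = \<rho> k"
    if "v \<in> codes M" "k < n - 1" for v k
    using feas \<tau>_in[OF that(1)] \<rho>_in[OF that(2)] by (simp add: feasible_def)

  \<comment> \<open>Opponents are chosen as codes so that \<open>beats\<close> decides the venues;
    \<open>opp_eq\<close> shows that the choice is unique.\<close>
  define opp where
    "opp k v = (SOME w. w \<in> codes M \<and> w \<noteq> v \<and> game_round S {\<tau> v, \<tau> w} = \<rho> k)" for k v
  have opp: "opp k v \<in> codes M \<and> opp k v \<noteq> v \<and> game_round S {\<tau> v, \<tau> (opp k v)} = \<rho> k"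
    if v: "v \<in> codes M" and k: "k < n - 1" for v k
    unfolding opp_def
  proof (rule someI_ex)
    obtain e where e: "e \<in> pairings n" "\<tau> v \<in> e" "game_round S e = \<rho> k"
      using unique_game[OF v k] by blast
    then obtain j where j: "e = {\<tau> v, j}" "j \<noteq> \<tau> v" "j \<in> teams n"
      by (auto simp: pairings_def card_2_iff)
    then obtain w where "w \<in> codes M" "\<tau> w = j" using \<tau>_surj by blast
    with e j show "\<exists>w. w \<in> codes M \<and> w \<noteq> v \<and> game_round S {\<tau> v, \<tau> w} = \<rho> k" by blast
  qed
  have game_of: "game_of n S (\<tau> v) (\<rho> k) = {\<tau> v, \<tau> (opp k v)}"
    if v: "v \<in> codes M" and k: "k < n - 1" for v k
    unfolding game_of_def
    by (rule the1_equality[OF unique_game[OF that]]) (use opp[OF that] pair[OF v, of "opp k v"] in auto)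
  have opp_eq: "opp k v = w" if v: "v \<in> codes M" and k: "k < n - 1"
    and w: "w \<in> codes M" "w \<noteq> v" "game_round S {\<tau> v, \<tau> w} = \<rho> k" for v w k
  proof -
    have "game_of n S (\<tau> v) (\<rho> k) = {\<tau> v, \<tau> w}"
      unfolding game_of_def
      by (rule the1_equality[OF unique_game[OF v k]]) (use w pair[OF v, of w] in auto)
    then have "\<tau> (opp k v) = \<tau> w"
      using game_of[OF v k] by (auto simp: doubleton_eq_iff)
    then show ?thesis using \<tau>_inj opp[OF v k] w by blast
  qed
  have hap: "hap n S (\<tau> v) (\<rho> k) = (if beats v (opp k v) then H else A)"
    if v: "v \<in> codes M" and k: "k < n - 1" for v k
    using host_team[of M S c v "opp k v"] sched c opp[OF v k] v game_of[OF v k]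
    unfolding hap_def venue_in_def \<tau>_def n by auto

  define br where "br v = (SOME k. k < n - 1 \<and> breaks n S (\<tau> v) = {\<rho> k})" for v
  have br: "br v < n - 1 \<and> breaks n S (\<tau> v) = {\<rho> (br v)}" if v: "v \<in> codes M" for v
    unfolding br_def
  proof (rule someI_ex)
    obtain r where r: "breaks n S (\<tau> v) = {r}"
      using single \<tau>_in[OF v] by (auto simp: single_break_def card_1_singleton_iff)
    then have "r \<in> rounds n" by (auto simp: breaks_def)
    with r show "\<exists>k. k < n - 1 \<and> breaks n S (\<tau> v) = {\<rho> k}" using \<rho>_surj by blast
  qed

  have "canonical_pattern M opp br"
  proof
    show "3 \<le> M" using assms n by simp
  next
    fix k v assume "k < 2 * M - 1" and v: "v \<in> codes M"
    then have k: "k < n - 1" using n by simp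
    show "opp k v \<in> codes M" "opp k v \<noteq> v" using opp[OF v k] by auto
    then show "opp k (opp k v) = v"
      using opp[OF v k] v k by (intro opp_eq) (auto simp: insert_commute)
  next
    fix k l v assume "k < 2 * M - 1" "l < 2 * M - 1" "v \<in> codes M" "opp k v = opp l v"
    then show "k = l" using opp[of v k] opp[of v l] \<rho>_inj[of k l] n by simp
  next
    fix v w assume vw: "v \<in> codes M" "w \<in> codes M" "v \<noteq> w"
    then have "game_round S {\<tau> v, \<tau> w} \<in> rounds n"
      using sched pair by (simp add: is_schedule_def)
    then obtain k where "k < n - 1" "\<rho> k = game_round S {\<tau> v, \<tau> w}" using \<rho>_surj by blast
    with vw n show "\<exists>k < 2 * M - 1. opp k v = w" using opp_eq by metis
  next
    fix k v assume "Suc k < 2 * M - 1" and v: "v \<in> codes M"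
    then have k: "Suc k < n - 1" using n by simp
    \<comment> \<open>Consecutive offsets are consecutive rounds even where the numbering wraps, so
      a break becomes a comparison of neighbouring offsets.\<close>
    have "prev_round n (\<rho> (Suc k)) = \<rho> k"
      unfolding \<rho>_def by (rule prev_cyclic_round[OF z k])
    then have "\<rho> (Suc k) \<in> breaks n S (\<tau> v) \<longleftrightarrow>
        (beats v (opp (Suc k) v) \<longleftrightarrow> beats v (opp k v))"
      using hap[OF v k] hap[OF v, of k] \<rho>_in[OF k] k by (auto simp: breaks_def)
    moreover have "\<rho> (Suc k) \<in> breaks n S (\<tau> v) \<longleftrightarrow> Suc k = br v"
      using br[OF v] \<rho>_inj[OF k] by auto
    ultimately show "(beats v (opp (Suc k) v) \<longleftrightarrow> beats v (opp k v)) \<longleftrightarrow> Suc k = br v" by simp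
  next
    fix v assume v: "v \<in> codes M"
    have "\<rho> (br v) \<in> (\<Union>i \<in> teams n. breaks n S i)" using br[OF v] \<tau>_in[OF v] by blast
    then show "br v \<in> break_offsets M" using z_iff br[OF v] unfolding \<rho>_def by blast
  next
    fix k assume k: "k \<in> break_offsets M"
    then have kn: "k < n - 1" using n by (simp add: break_offsets_def)
    then obtain i where "i \<in> teams n" "\<rho> k \<in> breaks n S i" using k z_iff unfolding \<rho>_def by blast
    moreover then obtain v where v: "v \<in> codes M" "\<tau> v = i" using \<tau>_surj by blast
    ultimately have "\<rho> k = \<rho> (br v)" using br[OF v(1)] by auto
    then show "\<exists>v \<in> codes M. br v = k" using \<rho>_inj[OF kn] br[OF v(1)] v(1) by metis
  qed
  then have "M \<le> 5" by (rule canonical_pattern.M_le_5)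
  then show False using assms n by simp
qed

end
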